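(* Let $X$ and $Y$ be Banach spaces such that (i) $X$ is isometric to a $1$-complemented subspace of $Y$ and $Y$ is isometric to a $1$-complemented subspace of $X$; (ii) $X$ and $Y$ are both isometrically square. Then $d_{\mathrm{BM}}(X,Y)\le 9+6\sqrt{3}$.
   Context: Banach spaces are over a fixed scalar field $\mathbb K\in\{\mathbb R,\mathbb C\}$ (the statement is for either choice). "Isometric" means isometrically isomorphic via a surjective linear isometry. A closed subspace $E$ of a Banach space $F$ is $1$-complemented if there is a bounded linear projection of $F$ onto $E$ of norm at most $1$. $X\oplus_\infty X$ denotes $X\times X$ with the norm $\|(x_1,x_2)\|=\max\{\|x_1\|,\|x_2\|\}$; a Banach space $X$ is isometrically square if there is a surjective linear isometry from $X$ onto $X\oplus_\infty X$. For isomorphic Banach spaces $X,Y$ the Banach--Mazur distance is $d_{\mathrm{BM}}(X,Y):=\inf\{\|T\|\,\|T^{-1}\| : T\colon X\to Y \text{ is a (linear) isomorphism}\}$; the conclusion includes that $X$ and $Y$ are isomorphic. *)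

theory Defs
  imports "HOL-Analysis.Analysis"
begin

text \<open>
  The scalar field is an arbitrary type of class \<^class>\<open>real_normed_field\<close>. By the theorem of
  Mazur, every such type is isometrically isomorphic, as a normed field over the reals, to the
  reals or to the complex numbers, and both \<^typ>\<open>real\<close> and \<^typ>\<open>complex\<close> are instances.

  A Banach space over this field is a type of class \<^class>\<open>banach\<close> together with a scalar
  multiplication that extends the real one and for which the norm is homogeneous. Hence the
  boundedness and operator norm notions of the library, which see only the real structure, are the
  usual ones.
\<close>

locale banach_over = vector_space scale
  for scale :: "'k::real_normed_field \<Rightarrow> 'a::banach \<Rightarrow> 'a" +
  assumes scale_of_real: "scale (of_real r) x = r *\<^sub>R x"
    and norm_scale: "norm (scale c x) = norm c * norm x"

lemma banach_over_real: "banach_over (scaleR :: real \<Rightarrow> 'a::banach \<Rightarrow> 'a)"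
  by unfold_locales (simp_all add: algebra_simps)

lemma banach_over_complex: "banach_over ((*) :: complex \<Rightarrow> complex \<Rightarrow> complex)"
  by unfold_locales (simp_all add: algebra_simps norm_mult scaleR_conv_of_real)

definition one_complemented ::
    "('k::real_normed_field \<Rightarrow> 'a::banach \<Rightarrow> 'a) \<Rightarrow> 'a set \<Rightarrow> bool" where
  "one_complemented sX E \<longleftrightarrow> module.subspace sX E \<and> closed E \<and>
     (\<exists>P. Vector_Spaces.linear sX sX P \<and> bounded_linear P \<and>
          P \<circ> P = P \<and> range P = E \<and> onorm P \<le> 1)"

definition isometric_to_subspace ::
    "('k::real_normed_field \<Rightarrow> 'a::banach \<Rightarrow> 'a) \<Rightarrow> ('k \<Rightarrow> 'b::banach \<Rightarrow> 'b) \<Rightarrow> 'b set \<Rightarrow> bool" where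
  "isometric_to_subspace sX sY E \<longleftrightarrow>
     (\<exists>T. Vector_Spaces.linear sX sY T \<and> range T = E \<and> (\<forall>x. norm (T x) = norm x))"

text \<open>
  The norm of the library on a product type is the Euclidean combination of the two norms, so the
  maximum norm is written out explicitly.
\<close>

definition max_norm :: "'a::real_normed_vector \<times> 'b::real_normed_vector \<Rightarrow> real" where
  "max_norm p = max (norm (fst p)) (norm (snd p))"

definition isometrically_square ::
    "('k::real_normed_field \<Rightarrow> 'a::banach \<Rightarrow> 'a) \<Rightarrow> bool" where
  "isometrically_square sX \<longleftrightarrow>
     (\<exists>T :: 'a \<Rightarrow> 'a \<times> 'a. Vector_Spaces.linear sX (module_prod.scale sX sX) T \<and>
        surj T \<and> (\<forall>x. max_norm (T x) = norm x))"

definition isomorphisms ::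
    "('k::real_normed_field \<Rightarrow> 'a::banach \<Rightarrow> 'a) \<Rightarrow> ('k \<Rightarrow> 'b::banach \<Rightarrow> 'b) \<Rightarrow> ('a \<Rightarrow> 'b) set" where
  "isomorphisms sX sY = {T. Vector_Spaces.linear sX sY T \<and> bij T \<and>
     bounded_linear T \<and> bounded_linear (inv T)}"

text \<open>
  The infimum is taken in the reals, so its value is meaningful only if
  \<^term>\<open>isomorphisms sX sY\<close> is nonempty.
\<close>

definition banach_mazur_dist ::
    "('k::real_normed_field \<Rightarrow> 'a::banach \<Rightarrow> 'a) \<Rightarrow> ('k \<Rightarrow> 'b::banach \<Rightarrow> 'b) \<Rightarrow> real" where
  "banach_mazur_dist sX sY = (INF T\<in>isomorphisms sX sY. onorm T * onorm (inv T))"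

end

theory Submission
  imports Defs
begin

text \<open>
  The proof is Pelczynski's decomposition argument with weights on the summands.
  If \<open>Y\<close> is a contractive retract of \<open>X\<close>, then \<open>X = Y \<oplus> B\<close> with \<open>B\<close> the kernel of the projection,
  and since \<open>Y = Y \<oplus> Y\<close> one of the two copies of \<open>Y\<close> can be split off without changing the space:
  \<open>X = Y \<oplus> B = (Y \<oplus> B) \<oplus> Y = X \<oplus> Y\<close>. By symmetry \<open>Y = X \<oplus> Y\<close>, so \<open>X\<close> and \<open>Y\<close> are isomorphic.

  For the constant, each absorption \<open>X = X \<oplus> Y\<close> carries two weights: \<open>s\<close> on the part of \<open>X\<close> that
  comes from \<open>Y\<close>, and \<open>t\<close> on the complement \<open>B\<close>, where the projection has norm at most \<open>2\<close>
  (lemma \<open>retract_absorbed\<close>). Its estimates are kept separately for the two coordinates and are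
  combined only after the two absorptions have been composed. With weights \<open>(1, t)\<close> for \<open>X\<close> and
  \<open>(1/m, 1/c)\<close> for \<open>Y\<close>, the composite and its inverse have norms at most
  \<open>max (1 + 2t) m + 2c\<close> and \<open>max 1 (1/m + 2/c) + 2/t\<close>. Both maxima are balanced by
  \<open>m = 1 + 2t\<close> and \<open>1/m + 2/c = 1\<close>, that is, \<open>c = (1 + 2t)/t\<close>. The product of the two bounds is
  then a function of \<open>t\<close> alone, and its minimum, at \<open>t = 1 + sqrt 3\<close>, is
  \<open>(6 + 3 sqrt 3) sqrt 3 = 9 + 6 sqrt 3\<close>.
\<close>

section \<open>Linear maps between Banach spaces over a normed field\<close>

lemma linear_over_imp_linear:
  assumes "banach_over sX" "banach_over sY" "Vector_Spaces.linear sX sY f"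
  shows "linear f"
proof (rule linearI)
  show "f (x + y) = f x + f y" for x y
    using assms(3) by (simp add: Vector_Spaces.linear_iff)
  fix r x
  have "f (sX (of_real r) x) = sY (of_real r) (f x)"
    using assms(3) by (simp add: Vector_Spaces.linear_iff)
  then show "f (r *\<^sub>R x) = r *\<^sub>R f x"
    using assms(1,2) by (simp add: banach_over.scale_of_real)
qed

lemma banach_over_scale_scaleR:
  assumes "banach_over sX"
  shows "sX k (r *\<^sub>R x) = r *\<^sub>R sX k x"
proof -
  interpret banach_over sX by fact
  show ?thesis
    by (simp flip: scale_of_real add: mult.commute)
qed

text \<open>
  The map \<open>p\<close> is the projection followed by the inverse of the isometry. In this form the
  hypotheses no longer mention subspaces, and \<open>i \<circ> p\<close> takes the place of the projection.
\<close>

lemma one_complemented_retraction: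
  assumes X: "banach_over sX" and Y: "banach_over sY"
    and E: "one_complemented sY E" "isometric_to_subspace sX sY E"
  obtains i p where "Vector_Spaces.linear sX sY i" "Vector_Spaces.linear sY sX p"
    "\<And>x. p (i x) = x" "\<And>x. norm (i x) \<le> norm x" "\<And>y. norm (p y) \<le> norm y"
proof -
  obtain P where P: "Vector_Spaces.linear sY sY P" "bounded_linear P" "P \<circ> P = P"
      "range P = E" "onorm P \<le> 1"
    using E(1) by (auto simp: one_complemented_def)
  obtain i where i: "Vector_Spaces.linear sX sY i" "range i = E" "\<And>x. norm (i x) = norm x"
    using E(2) by (auto simp: isometric_to_subspace_def)
  have "linear i"
    using X Y i(1) by (rule linear_over_imp_linear)
  have "inj i"
  proof (rule injI)
    fix x y assume "i x = i y"
    then have "norm (x - y) = 0"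
      using i(3)[of "x - y"] by (simp add: linear_diff[OF \<open>linear i\<close>])
    then show "x = y" by simp
  qed
  define p where "p = (\<lambda>y. inv i (P y))"
  have ip: "i (p y) = P y" for y
    unfolding p_def using P(4) i(2) by (metis f_inv_into_f rangeI)
  show thesis
  proof (rule that[OF i(1)])
    show "Vector_Spaces.linear sY sX p"
      unfolding Vector_Spaces.linear_iff
    proof (intro conjI allI)
      show "vector_space sY" "vector_space sX"
        using X Y by (auto simp: banach_over_def)
      show "p (x + y) = p x + p y" for x y
        using P(1) i(1) by (intro injD[OF \<open>inj i\<close>]) (simp add: ip Vector_Spaces.linear_iff)
      show "p (sY k y) = sX k (p y)" for k y
        using P(1) i(1) by (intro injD[OF \<open>inj i\<close>]) (simp add: ip Vector_Spaces.linear_iff)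
    qed
    show "p (i x) = x" for x
    proof (rule injD[OF \<open>inj i\<close>])
      obtain z where "i x = P z"
        using P(4) i(2) by blast
      then show "i (p (i x)) = i x"
        using P(3) by (simp add: ip) (metis comp_apply)
    qed
    show "norm (i x) \<le> norm x" for x
      by (simp add: i(3))
    show "norm (p y) \<le> norm y" for y
    proof -
      have "norm (p y) = norm (P y)"
        by (simp flip: ip i(3))
      also have "\<dots> \<le> onorm P * norm y"
        using P(2) by (rule onorm)
      also have "\<dots> \<le> 1 * norm y"
        using P(5) by (intro mult_right_mono) auto
      finally show ?thesis by simp
    qed
  qed
qed

section \<open>Decompositions into two summands\<close>

text \<open>
  An isomorphism of \<open>X\<close> with \<open>A \<oplus> B\<close>, given by its two coordinates \<open>f\<close>, \<open>h\<close> and its inverse \<open>g\<close>.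
  Keeping the coordinates apart makes it possible to estimate them separately, without a norm on
  the sum.
\<close>

definition decomposition where
  "decomposition sX sA sB f h g \<longleftrightarrow>
     Vector_Spaces.linear sX sA f \<and> Vector_Spaces.linear sX sB h \<and>
     (\<forall>a b. f (g a b) = a) \<and> (\<forall>a b. h (g a b) = b) \<and> (\<forall>x. g (f x) (h x) = x)"

lemma decompositionD:
  assumes "decomposition sX sA sB f h g"
  shows "Vector_Spaces.linear sX sA f" "Vector_Spaces.linear sX sB h"
    "f (g a b) = a" "h (g a b) = b" "g (f x) (h x) = x"
  using assms by (auto simp: decomposition_def)

lemma decomposition_inverse_linear:
  assumes "decomposition sX sA sB f h g"
  shows "g (a + a') (b + b') = g a b + g a' b'" "g (sA k a) (sB k b) = sX k (g a b)"
proof -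
  note d = decompositionD[OF assms]
  have add: "f (x + y) = f x + f y" "h (x + y) = h x + h y" for x y
    using d(1,2) by (simp_all add: Vector_Spaces.linear_iff)
  have scale: "f (sX k x) = sA k (f x)" "h (sX k x) = sB k (h x)" for k x
    using d(1,2) by (simp_all add: Vector_Spaces.linear_iff)
  show "g (a + a') (b + b') = g a b + g a' b'"
    using d(5)[of "g a b + g a' b'"] by (simp add: add d(3,4))
  show "g (sA k a) (sB k b) = sX k (g a b)"
    using d(5)[of "sX k (g a b)"] by (simp add: scale d(3,4))
qed

lemma isometrically_square_decomposition:
  assumes X: "banach_over sX" and sq: "isometrically_square sX"
  obtains f h g where "decomposition sX sX sX f h g"
    "\<And>x. norm (f x) \<le> norm x" "\<And>x. norm (h x) \<le> norm x"
    "\<And>a b. norm (g a b) \<le> max (norm a) (norm b)"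
proof -
  interpret X: banach_over sX by fact
  interpret XX: module_prod sX sX
    by unfold_locales
  obtain T where T: "Vector_Spaces.linear sX XX.scale T" "surj T" "\<And>x. max_norm (T x) = norm x"
    using sq by (auto simp: isometrically_square_def)
  have vs: "vector_space sX"
    using X by (simp add: banach_over_def)
  have add: "T (x + y) = T x + T y" and scale: "T (sX k x) = XX.scale k (T x)" for x y k
    using T(1) by (auto simp: Vector_Spaces.linear_iff)
  have "inj T"
  proof (rule injI)
    fix x y assume "T x = T y"
    then have "T (x - y) = 0"
      using add[of "x - y" y] by simp
    then have "norm (x - y) = 0"
      using T(3)[of "x - y"] by (simp add: max_norm_def)
    then show "x = y" by simp
  qed
  define g where "g = (\<lambda>a b. inv T (a, b))"
  have Tg: "T (g a b) = (a, b)" for a b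
    unfolding g_def using T(2) by (simp add: surj_f_inv_f)
  have gT: "g (fst (T x)) (snd (T x)) = x" for x
    by (simp add: g_def \<open>inj T\<close>)
  show thesis
  proof (rule that)
    show "decomposition sX sX sX (\<lambda>x. fst (T x)) (\<lambda>x. snd (T x)) g"
      unfolding decomposition_def Vector_Spaces.linear_iff
      by (auto simp: vs add scale Tg gT XX.scale_def split: prod.splits)
    show "norm (fst (T x)) \<le> norm x" "norm (snd (T x)) \<le> norm x" for x
      using T(3)[of x] by (auto simp: max_norm_def)
    show "norm (g a b) \<le> max (norm a) (norm b)" for a b
      using T(3)[of "g a b"] by (simp add: Tg max_norm_def)
  qed
qed

section \<open>Absorbing a retract\<close>

text \<open>
  Write \<open>X\<close> as \<open>Y \<oplus> B\<close>, where \<open>Y\<close> sits in \<open>X\<close> via \<open>j\<close>, with projection \<open>q\<close>, and \<open>B\<close> is the kernel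
  of \<open>q\<close>. Use \<open>Y = Y \<oplus> Y\<close> to split the coordinate in \<open>Y\<close>: its first half, together with the
  coordinate in \<open>B\<close>, is again an element of \<open>X\<close>, and its second half is the new summand. The
  factor \<open>2\<close> bounds the norm of the projection onto \<open>B\<close> along \<open>Y\<close>. The weights trade the
  bound for the isomorphism against the one for its inverse.
\<close>

lemma retract_absorbed:
  fixes sX :: "'k::real_normed_field \<Rightarrow> 'a::banach \<Rightarrow> 'a"
    and sY :: "'k \<Rightarrow> 'b::banach \<Rightarrow> 'b"
  assumes X: "banach_over sX" and Y: "banach_over sY"
    and F: "one_complemented sX F" "isometric_to_subspace sY sX F"
    and sq: "isometrically_square sY"
    and pos: "s > 0" "t > 0"
  obtains f h g where "decomposition sX sX sY f h g"
    "\<And>x. norm (f x) \<le> (s + 2 * t) * norm x" "\<And>x. norm (h x) \<le> norm x"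
    "\<And>x y. norm (g x y) \<le> max (norm x / s) (norm y) + 2 * norm x / t"
proof -
  obtain j q where j: "Vector_Spaces.linear sY sX j" and q: "Vector_Spaces.linear sX sY q"
      and qj: "\<And>y. q (j y) = y" and nj: "\<And>y. norm (j y) \<le> norm y"
      and nq: "\<And>x. norm (q x) \<le> norm x"
    using one_complemented_retraction[OF Y X F] by blast
  obtain v w d where vwd: "decomposition sY sY sY v w d"
      and nv: "\<And>y. norm (v y) \<le> norm y" and nw: "\<And>y. norm (w y) \<le> norm y"
      and nd: "\<And>a b. norm (d a b) \<le> max (norm a) (norm b)"
    using isometrically_square_decomposition[OF Y sq] by blast
  note D = decompositionD[OF vwd]
  interpret X: banach_over sX by fact
  interpret Y: banach_over sY by fact
  have vs: "vector_space sX" "vector_space sY"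
    using X Y by (simp_all add: banach_over_def)
  have lin: "linear j" "linear q" "linear v" "linear w"
    using j q D(1,2) linear_over_imp_linear X Y by blast+
  note lin_simps = lin[THEN linear_add] lin[THEN linear_diff] lin[THEN linear_scale]
  have scale: "j (sY k y) = sX k (j y)" "q (sX k x) = sY k (q x)"
      "v (sY k y) = sY k (v y)" "w (sY k y) = sY k (w y)" for k x y
    using j q D(1,2) by (simp_all add: Vector_Spaces.linear_iff)
  define b where "b = (\<lambda>x. x - j (q x))"
  have nb: "norm (b x) \<le> 2 * norm x" for x
  proof -
    have "norm (b x) \<le> norm x + norm (j (q x))"
      unfolding b_def by (rule norm_triangle_ineq4)
    also have "norm (j (q x)) \<le> norm x"
      using nj nq order_trans by blast
    finally show ?thesis by simp
  qed
  have q_b: "q (b x) = 0" for x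
    by (simp add: b_def lin_simps qj)
  have b_j: "b (j y) = 0" for y
    by (simp add: b_def qj)
  have "linear b"
    unfolding b_def by (intro linearI) (simp_all add: lin_simps algebra_simps)
  have b_b: "b (b x) = b x" for x
  proof -
    have "b (b x) = b x - j (q (b x))"
      by (simp only: b_def)
    then show ?thesis
      by (simp add: q_b linear_0[OF lin(1)])
  qed
  have b_scale: "b (sX k x) = sX k (b x)" for k x
    by (simp add: b_def scale X.scale_right_diff_distrib)
  note lin_simps = lin_simps \<open>linear b\<close>[THEN linear_add] \<open>linear b\<close>[THEN linear_scale]
  define f where "f = (\<lambda>x. s *\<^sub>R j (v (q x)) + t *\<^sub>R b x)"
  define h where "h = (\<lambda>x. w (q x))"
  define g where "g = (\<lambda>x y. j (d (q x /\<^sub>R s) y) + b x /\<^sub>R t)"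
  have q_g: "q (g x y) = d (q x /\<^sub>R s) y" and b_g: "b (g x y) = b x /\<^sub>R t" for x y
    by (simp_all add: g_def lin_simps qj q_b b_j b_b)
  have q_f: "q (f x) = s *\<^sub>R v (q x)" and b_f: "b (f x) = t *\<^sub>R b x" for x
    by (simp_all add: f_def lin_simps qj q_b b_j b_b)
  show thesis
  proof (rule that)
    show "decomposition sX sX sY f h g"
      unfolding decomposition_def Vector_Spaces.linear_iff
    proof (intro conjI allI)
      show "f (x + y) = f x + f y" "h (x + y) = h x + h y" for x y
        by (simp_all add: f_def h_def lin_simps algebra_simps)
      show "f (sX k x) = sX k (f x)" for k x
        by (simp add: f_def scale b_scale X.scale_right_distrib banach_over_scale_scaleR[OF X])
      show "h (sX k x) = sY k (h x)" for k x
        by (simp add: h_def scale)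
      show "f (g x y) = x" for x y
        using pos by (simp add: fun_cong[OF f_def, of "g x y"] q_g b_g D(3) lin_simps) (simp add: b_def)
      show "h (g x y) = y" for x y
        by (simp add: h_def q_g D(4))
      show "g (f x) (h x) = x" for x
        using pos by (simp add: g_def q_f b_f h_def D(5)) (simp add: b_def)
    qed (use vs in auto)
    show "norm (f x) \<le> (s + 2 * t) * norm x" for x
    proof -
      have "norm (f x) \<le> norm (s *\<^sub>R j (v (q x))) + norm (t *\<^sub>R b x)"
        unfolding f_def by (rule norm_triangle_ineq)
      also have "\<dots> = s * norm (j (v (q x))) + t * norm (b x)"
        using pos by simp
      also have "\<dots> \<le> s * norm x + t * (2 * norm x)"
        using pos nb nj[of "v (q x)"] nv[of "q x"] nq[of x]
        by (intro add_mono mult_left_mono) auto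
      finally show ?thesis by (simp add: algebra_simps)
    qed
    show "norm (h x) \<le> norm x" for x
      unfolding h_def using nw[of "q x"] nq[of x] by simp
    show "norm (g x y) \<le> max (norm x / s) (norm y) + 2 * norm x / t" for x y
    proof -
      have "norm (g x y) \<le> norm (j (d (q x /\<^sub>R s) y)) + norm (b x /\<^sub>R t)"
        unfolding g_def by (rule norm_triangle_ineq)
      also have "norm (j (d (q x /\<^sub>R s) y)) \<le> max (norm (q x /\<^sub>R s)) (norm y)"
        using nj nd order_trans by blast
      also have "\<dots> \<le> max (norm x / s) (norm y)"
        using pos nq[of x] by (intro max.mono) (auto simp: divide_simps)
      also have "norm (b x /\<^sub>R t) \<le> 2 * norm x / t"
        using pos nb[of x] by (simp add: divide_simps)
      finally show ?thesis by simp
    qed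
  qed
qed

section \<open>The isomorphism and its distortion\<close>

lemma onorm_mult_inv_le:
  assumes X: "banach_over sX" and Y: "banach_over sY"
    and T: "Vector_Spaces.linear sX sY T"
    and inverse: "\<And>y. T (S y) = y" "\<And>x. S (T x) = x"
    and bound: "\<And>x. norm (T x) \<le> K * norm x" "\<And>y. norm (S y) \<le> L * norm y"
    and "K \<ge> 0" "L \<ge> 0"
  shows "T \<in> isomorphisms sX sY" "onorm T * onorm (inv T) \<le> K * L"
proof -
  have "linear T"
    using X Y T by (rule linear_over_imp_linear)
  have "bij T"
    using inverse by (metis bijI')
  have inv: "inv T = S"
    using inverse by (intro inv_equality) auto
  have "linear S"
    using inverse by (intro linearI) (metis linear_add[OF \<open>linear T\<close>], metis linear_scale[OF \<open>linear T\<close>])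
  have bl: "bounded_linear T" "bounded_linear S"
    using \<open>linear T\<close> \<open>linear S\<close> bound
    by (auto intro!: bounded_linear_intro simp: linear_add linear_scale mult.commute)
  then show "T \<in> isomorphisms sX sY"
    using T \<open>bij T\<close> by (simp add: isomorphisms_def inv)
  have "onorm T \<le> K" "onorm S \<le> L"
    using bound \<open>K \<ge> 0\<close> \<open>L \<ge> 0\<close> by (auto intro: onorm_bound)
  then show "onorm T * onorm (inv T) \<le> K * L"
    using onorm_pos_le[OF bl(2)] \<open>K \<ge> 0\<close> by (simp add: inv mult_mono)
qed

theorem theoremB:
  fixes sX :: "'k::real_normed_field \<Rightarrow> 'a::banach \<Rightarrow> 'a"
    and sY :: "'k \<Rightarrow> 'b::banach \<Rightarrow> 'b"
  assumes "banach_over sX" and "banach_over sY"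
    and "\<exists>E. one_complemented sY E \<and> isometric_to_subspace sX sY E"
    and "\<exists>F. one_complemented sX F \<and> isometric_to_subspace sY sX F"
    and "isometrically_square sX" and "isometrically_square sY"
  shows "isomorphisms sX sY \<noteq> {} \<and> banach_mazur_dist sX sY \<le> 9 + 6 * sqrt 3"
proof -
  note X = assms(1) and Y = assms(2)
  obtain E F where E: "one_complemented sY E" "isometric_to_subspace sX sY E"
      and F: "one_complemented sX F" "isometric_to_subspace sY sX F"
    using assms(3,4) by blast
  define r :: real where "r = sqrt 3"
  have r: "r > 0" "r * r = 3"
    by (simp_all add: r_def)
  \<comment> \<open>The optimal \<open>t\<close>, together with \<open>m = 1 + 2 t\<close> and \<open>c = m / t\<close>, which balance the two maxima.\<close>
  define t where "t = 1 + r"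
  define m where "m = 3 + 2 * r"
  define c where "c = (3 + r) / 2"
  have pos: "t > 0" "m > 0" "c > 0"
    using r by (simp_all add: t_def m_def c_def)
  have balance: "1 / m + 2 / c = 1" "1 + 2 / t = r"
    using pos r by (simp_all add: t_def m_def c_def field_simps)
  obtain f h g where fhg: "decomposition sX sX sY f h g"
      and nf: "\<And>x. norm (f x) \<le> (1 + 2 * t) * norm x" and nh: "\<And>x. norm (h x) \<le> norm x"
      and ng: "\<And>x y. norm (g x y) \<le> max (norm x / 1) (norm y) + 2 * norm x / t"
    using retract_absorbed[OF X Y F assms(6) zero_less_one pos(1)] by blast
  obtain f' h' g' where fhg': "decomposition sY sY sX f' h' g'"
      and nf': "\<And>y. norm (f' y) \<le> (1 / m + 2 * (1 / c)) * norm y"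
      and nh': "\<And>y. norm (h' y) \<le> norm y"
      and ng': "\<And>y x. norm (g' y x) \<le> max (norm y / (1 / m)) (norm x) + 2 * norm y / (1 / c)"
    using retract_absorbed[OF Y X E assms(5), of "1 / m" "1 / c"] pos by auto
  note D = decompositionD[OF fhg] and D' = decompositionD[OF fhg']
  note L' = decomposition_inverse_linear[OF fhg']
  \<comment> \<open>\<open>T\<close> is \<open>X = X \<oplus> Y = Y \<oplus> X = Y\<close>, where the middle step interchanges the summands.\<close>
  define T where "T = (\<lambda>x. g' (h x) (f x))"
  define S where "S = (\<lambda>y. g (h' y) (f' y))"
  have T: "Vector_Spaces.linear sX sY T"
    using D(1,2) D'(1) by (auto simp: T_def Vector_Spaces.linear_iff L')
  have TS: "T (S y) = y" and ST: "S (T x) = x" for x y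
    by (simp_all add: T_def S_def D(3-5) D'(3-5))
  have nT: "norm (T x) \<le> (6 + 3 * r) * norm x" for x
  proof -
    have "norm (T x) \<le> max (m * norm (h x)) (norm (f x)) + 2 * c * norm (h x)"
      using ng'[of "h x" "f x"] by (simp add: T_def mult.commute mult.left_commute)
    also have "\<dots> \<le> m * norm x + 2 * c * norm x"
    proof (rule add_mono)
      show "max (m * norm (h x)) (norm (f x)) \<le> m * norm x"
        using nh[of x] nf[of x] pos by (simp add: m_def t_def mult_left_mono)
    qed (use nh[of x] pos in simp)
    also have "\<dots> = (6 + 3 * r) * norm x"
      by (simp add: m_def c_def algebra_simps)
    finally show ?thesis .
  qed
  have nS: "norm (S y) \<le> r * norm y" for y
  proof -
    have "norm (S y) \<le> max (norm (h' y)) (norm (f' y)) + 2 * norm (h' y) / t"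
      using ng[of "h' y" "f' y"] by (simp add: S_def)
    also have "\<dots> \<le> norm y + 2 * norm y / t"
      using nh'[of y] nf'[of y] balance(1) pos by (intro add_mono) (auto simp: divide_right_mono)
    also have "\<dots> = (1 + 2 / t) * norm y"
      by (simp add: algebra_simps)
    finally show ?thesis by (simp add: balance(2))
  qed
  note iso = onorm_mult_inv_le[OF X Y T TS ST nT nS]
  have mem: "T \<in> isomorphisms sX sY" and le: "onorm T * onorm (inv T) \<le> (6 + 3 * r) * r"
    using iso r by auto
  have "banach_mazur_dist sX sY \<le> onorm T * onorm (inv T)"
    unfolding banach_mazur_dist_def
  proof (rule cINF_lower[OF _ mem])
    show "bdd_below ((\<lambda>T. onorm T * onorm (inv T)) ` isomorphisms sX sY)"
      by (rule bdd_belowI2[where m = 0]) (auto simp: isomorphisms_def intro!: mult_nonneg_nonneg onorm_pos_le)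
  qed
  also note le
  also have "(6 + 3 * r) * r = 9 + 6 * sqrt 3"
    using r(2) by (simp add: algebra_simps flip: r_def)
  finally show ?thesis
    using mem by blast
qed

end
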